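(* Let $\mathbf{L}=\langle L,\leq\rangle$ be a complete lattice and $S$ an $L$-parameterization. An operator $C\colon L\to L$ is an $S$-closure operator in $\mathbf{L}$ if and only if $a\leq C(a)$ for all $a\in L$ and, for all $a,b\in L$ and all $\langle f,h\rangle\in S$, $a\leq h(C(b))$ implies $C(a)\leq h(C(b))$.
   Context: An isotone Galois connection in $\mathbf{L}$ is a pair $\langle f,h\rangle$ of maps $L\to L$ with $f(a)\leq b$ iff $a\leq h(b)$. An $L$-parameterization is a set $S$ of isotone Galois connections containing $\langle\mathrm{id},\mathrm{id}\rangle$. An $S$-closure operator is $C\colon L\to L$ with $a\leq C(a)$, $a\leq b$ implies $C(a)\leq C(b)$, and $C(h(C(a)))\leq h(C(a))$ for all $a,b\in L$ and $\langle f,h\rangle\in S$. *)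

theory Defs
  imports Main
begin

definition isotone_galois_connection :: "('a::order \<Rightarrow> 'a) \<Rightarrow> ('a \<Rightarrow> 'a) \<Rightarrow> bool" where
  "isotone_galois_connection f h \<longleftrightarrow> (\<forall>a b. f a \<le> b \<longleftrightarrow> a \<le> h b)"

definition L_parameterization :: "(('a::complete_lattice \<Rightarrow> 'a) \<times> ('a \<Rightarrow> 'a)) set \<Rightarrow> bool" where
  "L_parameterization S \<longleftrightarrow>
     (\<forall>(f, h) \<in> S. isotone_galois_connection f h) \<and> (id, id) \<in> S"

definition S_closure_operator ::
  "(('a::complete_lattice \<Rightarrow> 'a) \<times> ('a \<Rightarrow> 'a)) set \<Rightarrow> ('a \<Rightarrow> 'a) \<Rightarrow> bool" where
  "S_closure_operator S C \<longleftrightarrow>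
     (\<forall>a. a \<le> C a) \<and>
     (\<forall>a b. a \<le> b \<longrightarrow> C a \<le> C b) \<and>
     (\<forall>a. \<forall>(f, h) \<in> S. C (h (C a)) \<le> h (C a))"

end

theory Submission
  imports Defs
begin

text \<open>The implication says that each \<open>h (C b)\<close> bounds \<open>C a\<close> for
  every \<open>a\<close> below it. For monotone \<open>C\<close> this amounts to
  \<open>C (h (C b)) \<le> h (C b)\<close>, the case \<open>a = h (C b)\<close> being the extreme
  one. Monotonicity itself is recovered from extensivity and the identity pair in
  \<open>S\<close>.\<close>

theorem theorem32:
  fixes S :: "(('a::complete_lattice \<Rightarrow> 'a) \<times> ('a \<Rightarrow> 'a)) set"
    and C :: "'a \<Rightarrow> 'a"
  assumes "L_parameterization S"
  shows "S_closure_operator S C \<longleftrightarrow>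
    (\<forall>a. a \<le> C a) \<and>
    (\<forall>a b. \<forall>(f, h) \<in> S. a \<le> h (C b) \<longrightarrow> C a \<le> h (C b))"
    (is "_ \<longleftrightarrow> ?R")
proof
  assume cl: "S_closure_operator S C"
  have "C a \<le> h (C b)" if "(f, h) \<in> S" "a \<le> h (C b)" for a b f h
  proof -
    have "C a \<le> C (h (C b))"
      using cl that(2) unfolding S_closure_operator_def by blast
    also have "\<dots> \<le> h (C b)"
      using cl that(1) unfolding S_closure_operator_def by blast
    finally show ?thesis .
  qed
  then show ?R
    using cl unfolding S_closure_operator_def by auto
next
  assume R: ?R
  then have ext: "a \<le> C a" for a
    by blast
  have step: "C a \<le> h (C b)" if "(f, h) \<in> S" "a \<le> h (C b)" for a b f h
    using R that by blast
  have "C a \<le> C b" if "a \<le> b" for a b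
  proof -
    \<comment> \<open>For this pair \<open>step\<close> reads: \<open>a \<le> C b\<close> implies
      \<open>C a \<le> C b\<close>.\<close>
    have "(id, id) \<in> S"
      using assms unfolding L_parameterization_def by blast
    moreover have "a \<le> id (C b)"
      using order_trans[OF that ext] by simp
    ultimately show ?thesis
      using step by fastforce
  qed
  \<comment> \<open>The remaining condition is \<open>step\<close> at the point
    \<open>h (C a)\<close>, whose premise holds by reflexivity.\<close>
  then show "S_closure_operator S C"
    unfolding S_closure_operator_def using ext step by auto
qed

end
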